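(* Let $\mathscr C$ be a nowhere dense class of graphs and let $r\in\mathbb N$. There is a constant $k$ such that for every graph $G\in\mathscr C$ and every vertex $c\in V(G)$ (a Connector move), there are at most $k$ vertices $s\in V(G)$ that are $r$-progressing against $c$ in $G$.
   Context: A graph class $\mathscr C$ is nowhere dense if for every $d\in\mathbb N$ there is $t$ such that no graph in $\mathscr C$ contains the $d$-subdivision of $K_t$ as a subgraph. For a graph $H$ and vertex $u$, $B^r_H(u)=\{v\in V(H): \mathrm{dist}_H(u,v)\le r\}$. The radius-$r$ Splitter game on a graph $G$ is played by Splitter and Connector in rounds $i=1,2,\dots$ with initial arena $G_1=G$; in round $i$, Connector chooses a vertex $c_i\in V(G_i)$, then Splitter chooses a vertex $s_i\in V(G_i)$ and the new arena is $G_{i+1}=G_i[B^r_{G_i}(c_i)]-s_i$; Splitter wins when $G_{i+1}$ is the empty graph. The $r$-Splitter number of a graph is the minimum $\ell$ such that Splitter has a strategy to win the radius-$r$ game in at most $\ell$ rounds. Given $c\in V(G)$, a vertex $s\in V(G)$ is $r$-progressing against $c$ if the $r$-Splitter number of $G[B^r_G(c)]-s$ is strictly smaller than the $r$-Splitter number of $G[B^r_G(c)]$. *)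

theory Defs
  imports "Graph_Theory.Graph_Theory"
begin

text \<open>
  A (finite, simple, undirected) graph is a \<^term>\<open>G :: ('a, 'b) pre_digraph\<close> satisfying
  \<^const>\<open>graph\<close>, that is, every edge is represented by a pair of opposite arcs. A graph class is
  a set of such graphs; it is not required to be closed under isomorphism.
\<close>

definition complete_graph :: "nat \<Rightarrow> nat pair_pre_digraph" where
  "complete_graph t = \<lparr> pverts = {..<t}, parcs = {(i, j). i < t \<and> j < t \<and> i \<noteq> j} \<rparr>"

lemma complete_graph_complete: "K\<^bsub>t\<^esub> (with_proj (complete_graph t))"
  by (auto simp: complete_digraph_pair_def complete_graph_def)

datatype 'v subdiv_vertex = Orig 'v | Inner 'v 'v nat

text \<open>
  In the \<open>d\<close>-subdivision every edge is replaced by a path with \<open>d\<close> inner vertices, that is, of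
  length \<open>d + 1\<close>. The order on the vertices is only used to pick one orientation of each edge,
  so that the inner vertices are introduced once per edge.
\<close>

definition subdiv_path :: "nat \<Rightarrow> 'v \<Rightarrow> 'v \<Rightarrow> nat \<Rightarrow> 'v subdiv_vertex" where
  "subdiv_path d u v k = (if k = 0 then Orig u else if k = d + 1 then Orig v else Inner u v k)"

definition d_subdivision ::
  "nat \<Rightarrow> 'v::linorder pair_pre_digraph \<Rightarrow> 'v subdiv_vertex pair_pre_digraph" where
  "d_subdivision d H =
    (let P = {(subdiv_path d u v k, subdiv_path d u v (k + 1)) | u v k.
                (u, v) \<in> parcs H \<and> u < v \<and> k \<le> d}
     in \<lparr> pverts = Orig ` pverts H \<union>
                   {Inner u v k | u v k. (u, v) \<in> parcs H \<and> u < v \<and> 1 \<le> k \<and> k \<le> d},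
          parcs = P \<union> P\<inverse> \<rparr>)"

definition contains_subgraph :: "('a, 'b) pre_digraph \<Rightarrow> ('c, 'd) pre_digraph \<Rightarrow> bool" where
  "contains_subgraph G H \<longleftrightarrow> (\<exists>H'. subgraph H' G \<and> digraph_iso H H')"

definition nowhere_dense :: "('a, 'b) pre_digraph set \<Rightarrow> bool" where
  "nowhere_dense \<C> \<longleftrightarrow>
    (\<forall>d. \<exists>t. \<forall>G\<in>\<C>. \<not> contains_subgraph G (with_proj (d_subdivision d (complete_graph t))))"

definition graph_dist :: "('a, 'b) pre_digraph \<Rightarrow> 'a \<Rightarrow> 'a \<Rightarrow> ereal" where
  "graph_dist H u v = wf_digraph.\<mu> H (\<lambda>_. 1) u v"

definition dist_ball :: "('a, 'b) pre_digraph \<Rightarrow> nat \<Rightarrow> 'a \<Rightarrow> 'a set" where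
  "dist_ball H r u = {v \<in> verts H. graph_dist H u v \<le> ereal (real r)}"

definition next_arena ::
  "nat \<Rightarrow> ('a, 'b) pre_digraph \<Rightarrow> 'a \<Rightarrow> 'a \<Rightarrow> ('a, 'b) pre_digraph" where
  "next_arena r G c s = pre_digraph.del_vert (G \<restriction> dist_ball G r c) s"

text \<open>
  A Splitter strategy \<open>\<sigma>\<close> maps the nonempty list of Connector's moves made so far, most recent
  move first, to Splitter's reply. \<open>arena r G \<sigma> cs\<close> is the arena reached when Connector has made
  the moves \<open>cs\<close> (again most recent first) and Splitter has followed \<open>\<sigma>\<close>.
\<close>

primrec arena ::
  "nat \<Rightarrow> ('a, 'b) pre_digraph \<Rightarrow> ('a list \<Rightarrow> 'a) \<Rightarrow> 'a list \<Rightarrow> ('a, 'b) pre_digraph" where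
  "arena r G \<sigma> [] = G"
| "arena r G \<sigma> (c # cs) = next_arena r (arena r G \<sigma> cs) c (\<sigma> (c # cs))"

primrec legal_play ::
  "nat \<Rightarrow> ('a, 'b) pre_digraph \<Rightarrow> ('a list \<Rightarrow> 'a) \<Rightarrow> 'a list \<Rightarrow> bool" where
  "legal_play r G \<sigma> [] \<longleftrightarrow> True"
| "legal_play r G \<sigma> (c # cs) \<longleftrightarrow> legal_play r G \<sigma> cs \<and> c \<in> verts (arena r G \<sigma> cs)"

definition splitter_strategy :: "nat \<Rightarrow> ('a, 'b) pre_digraph \<Rightarrow> ('a list \<Rightarrow> 'a) \<Rightarrow> bool" where
  "splitter_strategy r G \<sigma> \<longleftrightarrow>
    (\<forall>c cs. legal_play r G \<sigma> (c # cs) \<longrightarrow> \<sigma> (c # cs) \<in> verts (arena r G \<sigma> cs))"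

text \<open>
  A play is won as soon as its arena is empty; hence winning in at most \<open>l\<close> rounds means that
  every play that is not yet won has lasted for fewer than \<open>l\<close> rounds. In particular, Splitter
  wins on the empty graph in \<open>0\<close> rounds.
\<close>

definition wins_within :: "nat \<Rightarrow> ('a, 'b) pre_digraph \<Rightarrow> ('a list \<Rightarrow> 'a) \<Rightarrow> nat \<Rightarrow> bool" where
  "wins_within r G \<sigma> l \<longleftrightarrow>
    (\<forall>cs. legal_play r G \<sigma> cs \<and> verts (arena r G \<sigma> cs) \<noteq> {} \<longrightarrow> length cs < l)"

definition splitter_number :: "nat \<Rightarrow> ('a, 'b) pre_digraph \<Rightarrow> nat" where
  "splitter_number r G = (LEAST l. \<exists>\<sigma>. splitter_strategy r G \<sigma> \<and> wins_within r G \<sigma> l)"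

definition r_progressing :: "nat \<Rightarrow> ('a, 'b) pre_digraph \<Rightarrow> 'a \<Rightarrow> 'a \<Rightarrow> bool" where
  "r_progressing r G c s \<longleftrightarrow> s \<in> verts G \<and>
    splitter_number r (pre_digraph.del_vert (G \<restriction> dist_ball G r c) s)
      < splitter_number r (G \<restriction> dist_ball G r c)"

lemma (in wf_digraph) dist_ball_iff:
  "v \<in> dist_ball G r u \<longleftrightarrow> (\<exists>p. awalk u p v \<and> length p \<le> r)"
proof -
  have cost: "awalk_cost (\<lambda>_. 1) p = real (length p)" for p :: "'b awalk"
    by (induction p) auto
  show ?thesis
  proof
    assume v: "v \<in> dist_ball G r u"
    show "\<exists>p. awalk u p v \<and> length p \<le> r"
    proof (rule ccontr)
      assume "\<not> ?thesis"
      then have "ereal (real (Suc r)) \<le> \<mu> (\<lambda>_. 1) u v"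
        unfolding \<mu>_def by (intro INF_greatest) (auto simp: cost not_le)
      moreover have "\<mu> (\<lambda>_. 1) u v \<le> ereal (real r)"
        using v by (simp add: dist_ball_def graph_dist_def)
      ultimately have "ereal (real (Suc r)) \<le> ereal (real r)" by (rule order_trans)
      then show False by simp
    qed
  next
    assume "\<exists>p. awalk u p v \<and> length p \<le> r"
    then obtain p where p: "awalk u p v" "length p \<le> r" by blast
    have "\<mu> (\<lambda>_. 1) u v \<le> ereal (real (length p))"
      using min_cost_le_walk_cost[OF p(1), of "\<lambda>_. 1"] by (simp add: cost)
    also have "\<dots> \<le> ereal (real r)" using p(2) by simp
    finally show "v \<in> dist_ball G r u"
      using p(1) by (auto simp: dist_ball_def graph_dist_def)
  qed
qed

lemma (in fin_digraph) splitter_number_exists: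
  "\<exists>l \<sigma>. splitter_strategy r G \<sigma> \<and> wins_within r G \<sigma> l"
proof (rule exI[of _ "card (verts G)"], rule exI[of _ hd], rule conjI)
  let ?\<sigma> = "hd :: 'a list \<Rightarrow> 'a"
  show "splitter_strategy r G ?\<sigma>"
    by (auto simp: splitter_strategy_def)
  have *: "finite (verts (arena r G ?\<sigma> cs)) \<and>
      (legal_play r G ?\<sigma> cs \<longrightarrow> card (verts (arena r G ?\<sigma> cs)) + length cs \<le> card (verts G))" for cs
  proof (induction cs)
    case (Cons c cs)
    let ?A = "arena r G ?\<sigma> cs"
    have fin: "finite (verts ?A)" using Cons by blast
    have sub: "verts (arena r G ?\<sigma> (c # cs)) \<subseteq> verts ?A - {c}"
      by (auto simp: next_arena_def pre_digraph.verts_del_vert dist_ball_def)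
    moreover have "finite (verts (arena r G ?\<sigma> (c # cs)))"
      using sub fin by (meson finite_Diff finite_subset)
    moreover have "card (verts (arena r G ?\<sigma> (c # cs))) < card (verts ?A)" if "c \<in> verts ?A"
      using sub fin that by (intro psubset_card_mono) auto
    ultimately show ?case using Cons by fastforce
  qed simp
  show "wins_within r G ?\<sigma> (card (verts G))"
    unfolding wins_within_def
  proof (intro allI impI)
    fix cs assume "legal_play r G ?\<sigma> cs \<and> verts (arena r G ?\<sigma> cs) \<noteq> {}"
    with *[of cs] have "0 < card (verts (arena r G ?\<sigma> cs))"
      "card (verts (arena r G ?\<sigma> cs)) + length cs \<le> card (verts G)"
      by (auto simp: card_gt_0_iff)
    then show "length cs < card (verts G)" by linarith
  qed
qed

lemma contains_subgraph_iff:
  assumes "wf_digraph G" "pair_wf_digraph H"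
  shows "contains_subgraph G (with_proj H) \<longleftrightarrow>
    (\<exists>f. inj_on f (pverts H) \<and> f ` pverts H \<subseteq> verts G \<and>
         (\<forall>(u, v)\<in>parcs H. (f u, f v) \<in> arcs_ends G))"
proof
  assume "contains_subgraph G (with_proj H)"
  then obtain h where h: "subgraph (app_iso h (with_proj H)) G"
      "pre_digraph.digraph_isomorphism (with_proj H) h"
    unfolding contains_subgraph_def digraph_iso_def by blast
  let ?f = "iso_verts h"
  have "(?f u, ?f v) \<in> arcs_ends G" if "(u, v) \<in> parcs H" for u v
  proof -
    have "iso_arcs h (u, v) \<in> arcs G" "iso_tail h = tail G" "iso_head h = head G"
      using h(1) that by (auto simp: subgraph_def compatible_def)
    moreover have "?f u = iso_tail h (iso_arcs h (u, v))" "?f v = iso_head h (iso_arcs h (u, v))"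
      using h(2) that by (force simp: pre_digraph.digraph_isomorphism_def)+
    ultimately show ?thesis by (auto simp: arcs_ends_conv)
  qed
  then show "\<exists>f. inj_on f (pverts H) \<and> f ` pverts H \<subseteq> verts G \<and>
      (\<forall>(u, v)\<in>parcs H. (f u, f v) \<in> arcs_ends G)"
    using h by (intro exI[of _ ?f] conjI)
      (auto simp: pre_digraph.digraph_isomorphism_def subgraph_def)
next
  assume "\<exists>f. inj_on f (pverts H) \<and> f ` pverts H \<subseteq> verts G \<and>
      (\<forall>(u, v)\<in>parcs H. (f u, f v) \<in> arcs_ends G)"
  then obtain f where f: "inj_on f (pverts H)" "f ` pverts H \<subseteq> verts G"
      "\<forall>(u, v)\<in>parcs H. (f u, f v) \<in> arcs_ends G"
    by (elim exE conjE)
  have "\<forall>e\<in>parcs H. \<exists>a\<in>arcs G. tail G a = f (fst e) \<and> head G a = f (snd e)"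
    using f(3) by (fastforce simp: arcs_ends_conv)
  then obtain g where g: "\<And>e. e \<in> parcs H \<Longrightarrow>
      g e \<in> arcs G \<and> tail G (g e) = f (fst e) \<and> head G (g e) = f (snd e)"
    by metis
  interpret H: pair_wf_digraph H by fact
  let ?h = "\<lparr>iso_verts = f, iso_arcs = g, iso_head = head G, iso_tail = tail G\<rparr>"
  have inj: "inj_on g (parcs H)"
  proof (rule inj_onI)
    fix e e' assume e: "e \<in> parcs H" "e' \<in> parcs H" "g e = g e'"
    then have "f (fst e) = f (fst e')" "f (snd e) = f (snd e')" using g by metis+
    with e f(1) show "e = e'"
      using H.arc_fst_in_verts H.arc_snd_in_verts by (metis inj_onD prod_eqI)
  qed
  have iso: "pre_digraph.digraph_isomorphism (with_proj H) ?h"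
    unfolding pre_digraph.digraph_isomorphism_def
    using f(1) g inj assms(2) by (auto simp: wf_digraph_wp_iff)
  have "wf_digraph (app_iso ?h (with_proj H))"
    using g H.in_arcsD1 H.in_arcsD2 by unfold_locales (auto intro!: imageI)
  then have "subgraph (app_iso ?h (with_proj H)) G"
    using assms(1) f(2) g by (auto simp: subgraph_def compatible_def)
  with iso show "contains_subgraph G (with_proj H)"
    unfolding contains_subgraph_def digraph_iso_def by blast
qed

lemma arena_snoc:
  "arena r G \<sigma> (cs @ [c]) = arena r (next_arena r G c (\<sigma> [c])) (\<lambda>h. \<sigma> (h @ [c])) cs"
  by (induction cs) auto

lemma legal_play_snoc:
  "legal_play r G \<sigma> (cs @ [c]) \<longleftrightarrow> c \<in> verts G \<and>
     legal_play r (next_arena r G c (\<sigma> [c])) (\<lambda>h. \<sigma> (h @ [c])) cs"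
  by (induction cs) (auto simp: arena_snoc)

lemma splitter_wins_0:
  "(\<exists>\<sigma>. splitter_strategy r G \<sigma> \<and> wins_within r G \<sigma> 0) \<longleftrightarrow> verts G = {}"
proof
  assume "\<exists>\<sigma>. splitter_strategy r G \<sigma> \<and> wins_within r G \<sigma> 0"
  then obtain \<sigma> where "wins_within r G \<sigma> 0" by blast
  from this[unfolded wins_within_def, rule_format, of "[]"] show "verts G = {}" by auto
next
  assume "verts G = {}"
  then have "\<not> legal_play r G \<sigma> (cs @ [c])" for \<sigma> cs c by (simp add: legal_play_snoc)
  then have "legal_play r G \<sigma> cs \<Longrightarrow> cs = []" for \<sigma> cs by (metis rev_exhaust)
  with \<open>verts G = {}\<close> show "\<exists>\<sigma>. splitter_strategy r G \<sigma> \<and> wins_within r G \<sigma> 0"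
    unfolding splitter_strategy_def wins_within_def by fastforce
qed

lemma splitter_wins_Suc:
  "(\<exists>\<sigma>. splitter_strategy r G \<sigma> \<and> wins_within r G \<sigma> (Suc l)) \<longleftrightarrow>
   (\<forall>c\<in>verts G. \<exists>s\<in>verts G.
      \<exists>\<sigma>. splitter_strategy r (next_arena r G c s) \<sigma> \<and> wins_within r (next_arena r G c s) \<sigma> l)"
proof
  assume "\<exists>\<sigma>. splitter_strategy r G \<sigma> \<and> wins_within r G \<sigma> (Suc l)"
  then obtain \<sigma> where \<sigma>: "splitter_strategy r G \<sigma>" "wins_within r G \<sigma> (Suc l)" by blast
  show "\<forall>c\<in>verts G. \<exists>s\<in>verts G.
      \<exists>\<sigma>. splitter_strategy r (next_arena r G c s) \<sigma> \<and> wins_within r (next_arena r G c s) \<sigma> l"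
  proof
    fix c assume c: "c \<in> verts G"
    let ?G = "next_arena r G c (\<sigma> [c])" and ?\<sigma> = "\<lambda>h. \<sigma> (h @ [c])"
    have mem: "\<sigma> [c] \<in> verts G"
      using \<sigma>(1)[unfolded splitter_strategy_def, rule_format, of c "[]"] c by simp
    have strat: "splitter_strategy r ?G ?\<sigma>"
      unfolding splitter_strategy_def
    proof (intro allI impI)
      fix c' cs assume "legal_play r ?G ?\<sigma> (c' # cs)"
      then have "legal_play r G \<sigma> (c' # (cs @ [c]))"
        using c by (simp add: legal_play_snoc arena_snoc)
      then show "\<sigma> ((c' # cs) @ [c]) \<in> verts (arena r ?G ?\<sigma> cs)"
        using \<sigma>(1)[unfolded splitter_strategy_def, rule_format, of c' "cs @ [c]"]
        by (simp add: arena_snoc)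
    qed
    have wins: "wins_within r ?G ?\<sigma> l"
      unfolding wins_within_def
    proof (intro allI impI)
      fix cs assume "legal_play r ?G ?\<sigma> cs \<and> verts (arena r ?G ?\<sigma> cs) \<noteq> {}"
      then have "legal_play r G \<sigma> (cs @ [c]) \<and> verts (arena r G \<sigma> (cs @ [c])) \<noteq> {}"
        using c by (simp add: legal_play_snoc arena_snoc)
      then have "length (cs @ [c]) < Suc l" using \<sigma>(2) unfolding wins_within_def by blast
      then show "length cs < l" by simp
    qed
    from mem strat wins show "\<exists>s\<in>verts G.
        \<exists>\<sigma>. splitter_strategy r (next_arena r G c s) \<sigma> \<and> wins_within r (next_arena r G c s) \<sigma> l"
      by blast
  qed
next
  assume "\<forall>c\<in>verts G. \<exists>s\<in>verts G.
      \<exists>\<sigma>. splitter_strategy r (next_arena r G c s) \<sigma> \<and> wins_within r (next_arena r G c s) \<sigma> l"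
  then obtain S T where ST: "\<And>c. c \<in> verts G \<Longrightarrow> S c \<in> verts G"
      "\<And>c. c \<in> verts G \<Longrightarrow> splitter_strategy r (next_arena r G c (S c)) (T c)"
      "\<And>c. c \<in> verts G \<Longrightarrow> wins_within r (next_arena r G c (S c)) (T c) l"
    by metis
  define \<sigma> where "\<sigma> h = (if butlast h = [] then S (last h) else T (last h) (butlast h))" for h
  have \<sigma>1: "\<sigma> [c] = S c" for c by (simp add: \<sigma>_def)
  have ar: "arena r G \<sigma> (cs @ [c]) = arena r (next_arena r G c (S c)) (T c) cs" for cs c
    by (induction cs) (simp_all add: \<sigma>_def)
  have lg: "legal_play r G \<sigma> (cs @ [c]) \<longleftrightarrow>
      c \<in> verts G \<and> legal_play r (next_arena r G c (S c)) (T c) cs" for cs c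
    by (induction cs) (auto simp: ar)
  show "\<exists>\<sigma>. splitter_strategy r G \<sigma> \<and> wins_within r G \<sigma> (Suc l)"
  proof (intro exI conjI)
    show "splitter_strategy r G \<sigma>"
      unfolding splitter_strategy_def
    proof (intro allI impI)
      fix c cs assume L: "legal_play r G \<sigma> (c # cs)"
      show "\<sigma> (c # cs) \<in> verts (arena r G \<sigma> cs)"
      proof (cases cs rule: rev_cases)
        case Nil
        then show ?thesis using L ST(1) by (simp add: \<sigma>1)
      next
        case (snoc cs' c')
        then have "c' \<in> verts G" "legal_play r (next_arena r G c' (S c')) (T c') (c # cs')"
          using L by (auto simp: lg ar)
        then have "T c' (c # cs') \<in> verts (arena r (next_arena r G c' (S c')) (T c') cs')"
          using ST(2) unfolding splitter_strategy_def by blast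
        then show ?thesis by (simp add: snoc ar \<sigma>_def)
      qed
    qed
    show "wins_within r G \<sigma> (Suc l)"
      unfolding wins_within_def
    proof (intro allI impI)
      fix cs assume L: "legal_play r G \<sigma> cs \<and> verts (arena r G \<sigma> cs) \<noteq> {}"
      show "length cs < Suc l"
      proof (cases cs rule: rev_cases)
        case (snoc cs' c')
        then show ?thesis using L ST(3)[of c'] by (auto simp: lg ar wins_within_def)
      qed simp
    qed
  qed
qed

end

theory Submission
  imports Defs "HOL-Library.Ramsey"
begin

text \<open>
  An arena on which Splitter does not win in \<open>l\<close> rounds contains one of size bounded in terms of
  \<open>l\<close> and \<open>r\<close>. If \<open>G[B(c)]\<close> has Splitter number \<open>l + 1\<close>, a progressing vertex must hit such a
  bounded set, so it only remains to bound the Splitter number on the class.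

  For this, let Splitter delete, after each move of Connector, short paths joining it to all earlier
  moves. A long play then yields vertices \<open>c\<^sub>i\<close> and short paths \<open>P\<^sub>i\<^sub>j\<close> with \<open>P\<^sub>i\<^sub>j\<close> disjoint from
  \<open>P\<^sub>k\<^sub>l\<close> whenever \<open>i < j < k < l\<close>. By Ramsey's theorem all coincidences between path vertices
  depend only on the order of the indices. The \<open>t\<close>-th vertex of \<open>P\<^sub>i\<^sub>j\<close> then depends on \<open>i\<close> only, on
  \<open>j\<close> only, or is injective in \<open>(i, j)\<close>; it cannot be constant by disjointness. Between a last
  position of the first kind and the next one of the second kind the paths form a subdivided
  half graph, which contains subdivisions of large cliques.
\<close>

section \<open>The game on vertex sets\<close>

text \<open>Every arena is an induced subgraph of one fixed graph, so \<open>adj\<close> never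
  changes and the vertex set \<open>A\<close> alone stands for the arena.\<close>

definition path_within :: "('a \<Rightarrow> 'a \<Rightarrow> bool) \<Rightarrow> 'a set \<Rightarrow> 'a \<Rightarrow> 'a list \<Rightarrow> 'a \<Rightarrow> bool" where
  "path_within adj A x p y \<longleftrightarrow>
    p \<noteq> [] \<and> hd p = x \<and> last p = y \<and> set p \<subseteq> A \<and> distinct p \<and> successively adj p"

definition set_ball :: "('a \<Rightarrow> 'a \<Rightarrow> bool) \<Rightarrow> nat \<Rightarrow> 'a set \<Rightarrow> 'a \<Rightarrow> 'a set" where
  \<comment> \<open>\<open>length p\<close> counts vertices, so the bound \<open>Suc r\<close> means
    radius \<open>r\<close>.\<close>
  "set_ball adj r A c = {v. \<exists>p. path_within adj A c p v \<and> length p \<le> Suc r}"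

primrec set_win :: "('a \<Rightarrow> 'a \<Rightarrow> bool) \<Rightarrow> nat \<Rightarrow> nat \<Rightarrow> 'a set \<Rightarrow> bool" where
  "set_win adj r 0 A \<longleftrightarrow> A = {}"
| "set_win adj r (Suc l) A \<longleftrightarrow> (\<forall>c\<in>A. \<exists>s\<in>A. set_win adj r l (set_ball adj r A c - {s}))"

lemma path_within_mono: "path_within adj A x p y \<Longrightarrow> A \<subseteq> B \<Longrightarrow> path_within adj B x p y"
  by (auto simp: path_within_def)

lemma set_ball_subset: "set_ball adj r A c \<subseteq> A"
  by (auto simp: set_ball_def path_within_def)

lemma set_ball_mono: "A \<subseteq> B \<Longrightarrow> set_ball adj r A c \<subseteq> set_ball adj r B c"
  unfolding set_ball_def by (blast intro: path_within_mono)

lemma centre_in_set_ball: "c \<in> A \<Longrightarrow> c \<in> set_ball adj r A c"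
  unfolding set_ball_def path_within_def by (auto intro!: exI[of _ "[c]"])

lemma path_subset_set_ball:
  assumes "path_within adj A c p v" "length p \<le> Suc r"
  shows "set p \<subseteq> set_ball adj r A c"
proof
  fix u assume "u \<in> set p"
  then obtain xs ys where p: "p = xs @ u # ys" by (auto dest: split_list)
  have "path_within adj A c (xs @ [u]) u"
    using assms(1) unfolding path_within_def p
    by (cases xs) (auto simp: successively_append_iff successively_Cons hd_append split: if_splits)
  moreover have "length (xs @ [u]) \<le> Suc r" using assms(2) p by simp
  ultimately show "u \<in> set_ball adj r A c" unfolding set_ball_def by blast
qed

text \<open>Splitter copies the reply \<open>s\<close> made in the larger arena; if \<open>s\<close>
  is absent from the smaller one, nothing has to be removed and Connector's own vertex is a harmless
  legal reply.\<close>

lemma set_win_mono: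
  assumes "set_win adj r l A" "B \<subseteq> A"
  shows "set_win adj r l B"
  using assms
proof (induction l arbitrary: A B)
  case (Suc l)
  show ?case unfolding set_win.simps
  proof
    fix c assume c: "c \<in> B"
    then obtain s where s: "set_win adj r l (set_ball adj r A c - {s})" using Suc.prems by auto
    have sub: "set_ball adj r B c \<subseteq> set_ball adj r A c" by (rule set_ball_mono[OF Suc.prems(2)])
    show "\<exists>s\<in>B. set_win adj r l (set_ball adj r B c - {s})"
    proof (cases "s \<in> B")
      case True
      show ?thesis by (rule bexI[OF Suc.IH[OF s] True]) (use sub in auto)
    next
      case False
      then have "set_ball adj r B c - {c} \<subseteq> set_ball adj r A c - {s}"
        using sub set_ball_subset[of adj r B c] by auto
      then show ?thesis by (rule bexI[OF Suc.IH[OF s] c])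
    qed
  qed
qed auto

lemma set_win_Suc: "set_win adj r l A \<Longrightarrow> set_win adj r (Suc l) A"
proof -
  assume win: "set_win adj r l A"
  show ?thesis unfolding set_win.simps
  proof
    fix c assume "c \<in> A"
    moreover have "set_win adj r l (set_ball adj r A c - {c})"
      by (rule set_win_mono[OF win]) (use set_ball_subset[of adj r A c] in blast)
    ultimately show "\<exists>s\<in>A. set_win adj r l (set_ball adj r A c - {s})" by blast
  qed
qed

lemma set_win_le: "l \<le> l' \<Longrightarrow> set_win adj r l A \<Longrightarrow> set_win adj r l' A"
  by (induction l' rule: dec_induct) (auto intro: set_win_Suc simp del: set_win.simps)

section \<open>Losing arenas of bounded size\<close>

text \<open>To make a losing arena of bounded size, keep a losing arena for one reply of Splitter, and one
  for each of the boundedly many replies that hit it; the paths to Connector's move keep all of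
  them inside the ball.\<close>

primrec obstruction_bound :: "nat \<Rightarrow> nat \<Rightarrow> nat" where
  "obstruction_bound r 0 = 1"
| "obstruction_bound r (Suc l) =
    1 + Suc (obstruction_bound r l) * obstruction_bound r l * Suc r"

lemma small_obstruction:
  assumes "\<not> set_win adj r l A"
  shows "\<exists>W\<subseteq>A. finite W \<and> card W \<le> obstruction_bound r l \<and> \<not> set_win adj r l W"
  using assms
proof (induction l arbitrary: A)
  case 0
  then obtain a where "a \<in> A" by auto
  then show ?case by (intro exI[of _ "{a}"]) auto
next
  case (Suc l)
  let ?N = "obstruction_bound r l"
  from Suc.prems obtain c where c: "c \<in> A"
    and lose: "\<And>s. s \<in> A \<Longrightarrow> \<not> set_win adj r l (set_ball adj r A c - {s})" by auto
  have "\<forall>s\<in>A. \<exists>W. W \<subseteq> set_ball adj r A c - {s} \<and> finite W \<and> card W \<le> ?N \<and> \<not> set_win adj r l W"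
    using Suc.IH[OF lose] by blast
  then obtain W where W: "\<And>s. s \<in> A \<Longrightarrow> W s \<subseteq> set_ball adj r A c - {s}"
      "\<And>s. s \<in> A \<Longrightarrow> finite (W s)" "\<And>s. s \<in> A \<Longrightarrow> card (W s) \<le> ?N"
      "\<And>s. s \<in> A \<Longrightarrow> \<not> set_win adj r l (W s)" by metis
  have WA: "W s \<subseteq> A" if "s \<in> A" for s
    using W(1)[OF that] set_ball_subset[of adj r A c] by blast
  \<comment> \<open>A reply that misses \<open>W c\<close> leaves \<open>W c\<close> intact, so only
    replies in \<open>W c\<close> need sets of their own. Including \<open>c\<close> in
    \<open>I\<close> puts \<open>W c\<close> itself into \<open>U\<close>.\<close>
  define I where "I = insert c (W c)"
  define U where "U = (\<Union>s\<in>I. W s)"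
  have I: "I \<subseteq> A" "finite I" "card I \<le> Suc ?N"
    using WA[OF c] W(2)[OF c] W(3)[OF c] c card_insert_le_m1
    by (auto simp: I_def card_insert_if)
  have "card U \<le> (\<Sum>s\<in>I. card (W s))" unfolding U_def by (rule card_UN_le[OF I(2)])
  also have "\<dots> \<le> card I * ?N" using sum_bounded_above[of I "\<lambda>s. card (W s)" ?N] I(1) W(3) by auto
  also have "\<dots> \<le> Suc ?N * ?N" using I(3) by (rule mult_le_mono1)
  finally have cardU: "card U \<le> Suc ?N * ?N" .
  have finU: "finite U" using I W(2) unfolding U_def by blast
  have "\<forall>v\<in>U. \<exists>p. path_within adj A c p v \<and> length p \<le> Suc r"
    using W(1) I(1) unfolding U_def set_ball_def by blast
  then obtain p where p: "\<And>v. v \<in> U \<Longrightarrow> path_within adj A c (p v) v"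
      "\<And>v. v \<in> U \<Longrightarrow> length (p v) \<le> Suc r" by metis
  define X where "X = insert c (\<Union>v\<in>U. set (p v))"
  have "card (\<Union>v\<in>U. set (p v)) \<le> (\<Sum>v\<in>U. card (set (p v)))" by (rule card_UN_le[OF finU])
  also have "\<dots> \<le> card U * Suc r"
    using sum_bounded_above[of U "\<lambda>v. card (set (p v))" "Suc r"] p(2) card_length
    by (metis (no_types, lifting) le_trans of_nat_id)
  also have "\<dots> \<le> Suc ?N * ?N * Suc r" using cardU by (rule mult_le_mono1)
  finally have "card X \<le> obstruction_bound r (Suc l)"
    unfolding X_def using finU by (simp add: card_insert_if)
  moreover have "finite X" "X \<subseteq> A" using finU c p(1) by (auto simp: X_def path_within_def)
  moreover have "U \<subseteq> set_ball adj r X c"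
  proof
    fix v assume v: "v \<in> U"
    then have "path_within adj X c (p v) v" using p(1)[OF v] by (auto simp: path_within_def X_def)
    then show "v \<in> set_ball adj r X c" using p(2)[OF v] unfolding set_ball_def by blast
  qed
  moreover have "\<not> set_win adj r (Suc l) X"
  proof
    assume "set_win adj r (Suc l) X"
    then obtain s where s: "s \<in> X" "set_win adj r l (set_ball adj r X c - {s})"
      by (auto simp: X_def)
    have sA: "s \<in> A" using s(1) \<open>X \<subseteq> A\<close> by blast
    show False
    proof (cases "s \<in> I")
      case True
      then have "W s \<subseteq> set_ball adj r X c - {s}"
        using \<open>U \<subseteq> set_ball adj r X c\<close> W(1)[OF sA] unfolding U_def by blast
      then show False using set_win_mono[OF s(2)] W(4)[OF sA] by blast
    next
      case False
      then have "W c \<subseteq> set_ball adj r X c - {s}"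
        using \<open>U \<subseteq> set_ball adj r X c\<close> unfolding U_def I_def by blast
      then show False using set_win_mono[OF s(2)] W(4)[OF c] by blast
    qed
  qed
  ultimately show ?case by blast
qed

text \<open>Splitter spends one round on each vertex of \<open>S\<close>; shrinking to balls
  meanwhile does no harm by \<open>set_win_mono\<close>.\<close>

lemma set_win_delete:
  assumes "finite S" "set_win adj r l (B - S)"
  shows "set_win adj r (card S + l) B"
  using assms
proof (induction S arbitrary: B)
  case (insert s S)
  have win: "set_win adj r (card S + l) (B - {s})"
    by (rule insert.IH) (metis insert.prems Diff_insert2)
  have "\<exists>s'\<in>B. set_win adj r (card S + l) (set_ball adj r B c - {s'})" if c: "c \<in> B" for c
  proof (cases "s \<in> B")
    case True
    have "set_ball adj r B c - {s} \<subseteq> B - {s}" using set_ball_subset[of adj r B c] by blast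
    then show ?thesis using set_win_mono[OF win] True by blast
  next
    case False
    then have "set_ball adj r B c - {c} \<subseteq> B - {s}" using set_ball_subset[of adj r B c] by blast
    then show ?thesis using set_win_mono[OF win] c by blast
  qed
  then show ?case using insert.hyps by simp
qed simp

text \<open>This lets Splitter answer one move by deleting \<open>m\<close> vertices at once: by
  \<open>set_win_delete\<close> the deletions cost \<open>m\<close> rounds, and one more pays for
  the move itself.\<close>

lemma batch_move:
  assumes "\<not> set_win adj r (Suc (m + l)) A"
  shows "\<exists>c\<in>A. \<forall>S. finite S \<longrightarrow> card S \<le> m \<longrightarrow> \<not> set_win adj r l (set_ball adj r A c - S)"
proof -
  from assms obtain c where c: "c \<in> A"
    and lose: "\<And>s. s \<in> A \<Longrightarrow> \<not> set_win adj r (m + l) (set_ball adj r A c - {s})" by auto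
  have "\<not> set_win adj r l (set_ball adj r A c - S)" if S: "finite S" "card S \<le> m" for S
  proof
    assume "set_win adj r l (set_ball adj r A c - S)"
    then have "set_win adj r (card S + l) (set_ball adj r A c)" by (rule set_win_delete[OF S(1)])
    then have "set_win adj r (m + l) (set_ball adj r A c)" using S(2) set_win_le by (metis add_le_mono1)
    then show False using lose[OF c] set_win_mono by (metis Diff_subset)
  qed
  with c show ?thesis by blast
qed

text \<open>Splitter deletes the paths from all earlier moves of Connector to the current one, so paths
  completed earlier avoid those that start later.\<close>

lemma long_play_paths:
  assumes lose: "\<not> set_win adj r (n * Suc (n * Suc r)) V"
  shows "\<exists>c P. (\<forall>i j. i < j \<longrightarrow> j < n \<longrightarrow>
      path_within adj V (c i) (P i j) (c j) \<and> length (P i j) \<le> Suc r) \<and>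
    (\<forall>i j k l. i < j \<longrightarrow> j < k \<longrightarrow> k < l \<longrightarrow> l < n \<longrightarrow> set (P i j) \<inter> set (P k l) = {})"
proof -
  define m where "m = n * Suc r"
  \<comment> \<open>A fixed choice makes the paths deleted by Splitter the same as the paths
    returned at the end.\<close>
  define pth where "pth A x y = (SOME p. path_within adj A x p y \<and> length p \<le> Suc r)" for A x y
  have pth: "path_within adj A x (pth A x y) y \<and> length (pth A x y) \<le> Suc r"
    if "y \<in> set_ball adj r A x" for A x y
    using that unfolding pth_def set_ball_def mem_Collect_eq by (rule someI_ex)
  \<comment> \<open>Invariant after \<open>q\<close> rounds. Each round deletes at most
    \<open>n\<close> paths with at most \<open>Suc r\<close> vertices each, so at most
    \<open>m\<close> vertices, and \<open>batch_move\<close> uses up \<open>Suc m\<close> of the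
    budget.\<close>
  have "\<exists>A c. A 0 = V \<and> (\<forall>i<q. c i \<in> A i \<and>
          A (Suc i) = set_ball adj r (A i) (c i) - (\<Union>j<i. set (pth (A j) (c j) (c i)))) \<and>
        \<not> set_win adj r ((n - q) * Suc m) (A q)" if "q \<le> n" for q
    using that
  proof (induction q)
    case 0
    then show ?case using lose by (intro exI[of _ "\<lambda>_. V"]) (simp add: m_def)
  next
    case (Suc q)
    then obtain A c where A0: "A 0 = V"
      and step: "\<And>i. i < q \<Longrightarrow> c i \<in> A i \<and>
          A (Suc i) = set_ball adj r (A i) (c i) - (\<Union>j<i. set (pth (A j) (c j) (c i)))"
      and lose': "\<not> set_win adj r ((n - q) * Suc m) (A q)" by auto
    have "(n - q) * Suc m = Suc (m + (n - Suc q) * Suc m)"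
      using Suc.prems by (simp flip: Suc_diff_Suc)
    with lose' obtain x where x: "x \<in> A q"
      and xlose: "\<And>S. finite S \<Longrightarrow> card S \<le> m \<Longrightarrow>
        \<not> set_win adj r ((n - Suc q) * Suc m) (set_ball adj r (A q) x - S)"
      using batch_move by metis
    have sub: "A (Suc i) \<subseteq> set_ball adj r (A i) (c i)" if "i < q" for i using step[OF that] by blast
    have anti: "A b \<subseteq> A a" if "a \<le> b" "b \<le> q" for a b
      using that
    proof (induction b rule: dec_induct)
      case (step b)
      then show ?case using sub[of b] set_ball_subset[of adj r "A b" "c b"] by auto
    qed simp
    let ?S = "\<Union>j<q. set (pth (A j) (c j) x)"
    have len: "length (pth (A j) (c j) x) \<le> Suc r" if "j < q" for j
      using pth sub[OF that] anti[of "Suc j" q] x that by (meson Suc_leI order_refl subsetD)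
    have "card ?S \<le> (\<Sum>j<q. card (set (pth (A j) (c j) x)))" by (rule card_UN_le) simp
    also have "\<dots> \<le> q * Suc r"
      using sum_bounded_above[of "{..<q}" "\<lambda>j. card (set (pth (A j) (c j) x))" "Suc r"] len
      by (auto intro: le_trans[OF card_length])
    also have "\<dots> \<le> m" unfolding m_def using Suc.prems by (intro mult_le_mono1) simp
    finally have "\<not> set_win adj r ((n - Suc q) * Suc m) (set_ball adj r (A q) x - ?S)"
      by (intro xlose) auto
    then show ?case using A0 step x
      by (intro exI[of _ "A(Suc q := set_ball adj r (A q) x - ?S)"] exI[of _ "c(q := x)"])
        (auto simp: less_Suc_eq simp del: set_win.simps)
  qed
  from this[of n] obtain A c where A0: "A 0 = V"
    and step: "\<And>i. i < n \<Longrightarrow> c i \<in> A i \<and>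
        A (Suc i) = set_ball adj r (A i) (c i) - (\<Union>j<i. set (pth (A j) (c j) (c i)))" by auto
  have sub: "A (Suc i) \<subseteq> set_ball adj r (A i) (c i)" if "i < n" for i using step[OF that] by blast
  have anti: "A b \<subseteq> A a" if "a \<le> b" "b \<le> n" for a b
    using that
  proof (induction b rule: dec_induct)
    case (step b)
    then show ?case using sub[of b] set_ball_subset[of adj r "A b" "c b"] by auto
  qed simp
  define P where "P i j = pth (A i) (c i) (c j)" for i j
  have P: "path_within adj (A i) (c i) (P i j) (c j) \<and> length (P i j) \<le> Suc r"
    if "i < j" "j < n" for i j
    unfolding P_def using sub[of i] anti[of "Suc i" j] step[of j] that by (intro pth) auto
  have "path_within adj V (c i) (P i j) (c j) \<and> length (P i j) \<le> Suc r" if "i < j" "j < n" for i j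
    using P[OF that] anti[of 0 i] A0 that path_within_mono by fastforce
  moreover have "set (P i j) \<inter> set (P k l) = {}" if "i < j" "j < k" "k < l" "l < n" for i j k l
  proof -
    \<comment> \<open>\<open>P i j\<close> is deleted in round \<open>j\<close>, while
      \<open>P k l\<close> is chosen inside the later arena \<open>A k\<close>.\<close>
    have "A (Suc j) \<inter> set (P i j) = {}" using step[of j] that by (auto simp: P_def)
    moreover have "set (P k l) \<subseteq> A k" using P[of k l] that by (auto simp: path_within_def)
    moreover have "A k \<subseteq> A (Suc j)" using anti[of "Suc j" k] that by auto
    ultimately show ?thesis by blast
  qed
  ultimately show ?thesis by (intro exI[of _ c] exI[of _ P]) auto
qed

section \<open>Subdivided cliques from homogeneous systems of paths\<close>

text \<open>Ramsey's theorem for sets of four, since two paths have four ends; tuples are read in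
  increasing order, and \<open>e\<close> enumerates the homogeneous set.\<close>

lemma ramsey_increasing:
  fixes K :: "'k set" and m :: nat
  assumes "finite K"
  shows "\<exists>N::nat. \<forall>f. (\<forall>i j k l. i < j \<longrightarrow> j < k \<longrightarrow> k < l \<longrightarrow> l < N \<longrightarrow> f i j k l \<in> K) \<longrightarrow>
    (\<exists>e col. (\<forall>j<m. e j < N) \<and> (\<forall>i j. i < j \<longrightarrow> j < m \<longrightarrow> e i < e j) \<and>
      (\<forall>i j k l. i < j \<longrightarrow> j < k \<longrightarrow> k < l \<longrightarrow> l < m \<longrightarrow> f (e i) (e j) (e k) (e l) = col))"
proof -
  \<comment> \<open>In \<open>partn_lst\<close> the colours are list indices, so \<open>h\<close>
    numbers \<open>K\<close>; every colour is asked for a homogeneous set of the same size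
    \<open>m\<close>.\<close>
  obtain h where h: "bij_betw h K {..<card K}"
    using ex_bij_betw_finite_nat[OF assms] by (auto simp: atLeast0LessThan)
  obtain N :: nat where N: "partn_lst {..<N} (replicate (card K) m) 4"
    using ramsey_full by blast
  show ?thesis
  proof (intro exI[of _ N] allI impI)
    fix f :: "nat \<Rightarrow> nat \<Rightarrow> nat \<Rightarrow> nat \<Rightarrow> 'k"
    assume f: "\<forall>i j k l. i < j \<longrightarrow> j < k \<longrightarrow> k < l \<longrightarrow> l < N \<longrightarrow> f i j k l \<in> K"
    define g where "g X = (let xs = sorted_list_of_set X in h (f (xs!0) (xs!1) (xs!2) (xs!3)))" for X
    have g: "g {i, j, k, l} = h (f i j k l)" if "i < j" "j < k" "k < l" for i j k l
    proof -
      have "sorted_list_of_set {i, j, k, l} = [i, j, k, l]"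
        using that by simp
      then show ?thesis by (simp add: g_def)
    qed
    have "g X < card K" if X: "X \<in> nsets {..<N} 4" for X
    proof -
      let ?xs = "sorted_list_of_set X"
      have X': "X \<subseteq> {..<N}" "finite X" "card X = 4" using X by (auto simp: nsets_def)
      have "length ?xs = 4" using X' by simp
      moreover have "strict_sorted ?xs" by simp
      ultimately have "?xs!0 < ?xs!1" "?xs!1 < ?xs!2" "?xs!2 < ?xs!3"
        by (simp_all add: sorted_wrt_iff_nth_less)
      moreover have "?xs!3 < N" using X' \<open>length ?xs = 4\<close>
        using nth_mem[of 3 ?xs] by auto
      ultimately have "f (?xs!0) (?xs!1) (?xs!2) (?xs!3) \<in> K" using f by blast
      then show ?thesis using bij_betwE[OF h] by (auto simp: g_def Let_def)
    qed
    then have "g \<in> nsets {..<N} 4 \<rightarrow> {..<length (replicate (card K) m)}" by auto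
    with N obtain i where "i < card K" "monochromatic {..<N} (replicate (card K) m ! i) 4 g i"
      unfolding partn_lst_def by auto
    then obtain H where H: "H \<in> nsets {..<N} m" "\<And>X. X \<in> nsets H 4 \<Longrightarrow> g X = i"
      unfolding monochromatic_def by auto
    have H': "H \<subseteq> {..<N}" "finite H" "card H = m" using H(1) by (auto simp: nsets_def)
    define e where "e j = sorted_list_of_set H ! j" for j
    have eH: "e j \<in> H" if "j < m" for j
      using H' that by (metis e_def length_sorted_list_of_set nth_mem set_sorted_list_of_set)
    have e: "e i < e j" if "i < j" "j < m" for i j
      using that H' sorted_wrt_nth_less[OF strict_sorted_list_of_set, of i j H] by (simp add: e_def)
    have "f (e i1) (e i2) (e i3) (e i4) = the_inv_into K h i"
      if "i1 < i2" "i2 < i3" "i3 < i4" "i4 < m" for i1 i2 i3 i4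
    proof -
      have lt: "e i1 < e i2" "e i2 < e i3" "e i3 < e i4" using e that by auto
      have "{e i1, e i2, e i3, e i4} \<in> nsets H 4"
        using eH that lt by (auto simp: nsets_def card_insert_if)
      then have "h (f (e i1) (e i2) (e i3) (e i4)) = i" using H(2) g[OF lt] by simp
      moreover have "f (e i1) (e i2) (e i3) (e i4) \<in> K" using f lt eH[of i4] that H' by auto
      ultimately show ?thesis using the_inv_into_f_f[of h K] h by (auto simp: bij_betw_def)
    qed
    then show "\<exists>e col. (\<forall>j<m. e j < N) \<and> (\<forall>i j. i < j \<longrightarrow> j < m \<longrightarrow> e i < e j) \<and>
      (\<forall>i j k l. i < j \<longrightarrow> j < k \<longrightarrow> k < l \<longrightarrow> l < m \<longrightarrow> f (e i) (e j) (e k) (e l) = col)"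
      using e subsetD[OF H'(1) eH] by (intro exI[of _ e] exI[of _ "the_inv_into K h i"]) auto
  qed
qed

lemma pair_wf_d_subdivision_complete: "pair_wf_digraph (d_subdivision d (complete_graph t))"
proof -
  have "x \<in> pverts (d_subdivision d (complete_graph t)) \<and> y \<in> pverts (d_subdivision d (complete_graph t))"
    if "(x, y) \<in> parcs (d_subdivision d (complete_graph t))"
    for x y
    using that by (fastforce simp: d_subdivision_def complete_graph_def subdiv_path_def Let_def)
  then show ?thesis by unfold_locales auto
qed

text \<open>This is what Ramsey's theorem leaves. In \<open>homogeneous\<close>, the pairs
  \<open>p\<close>, \<open>q\<close> and \<open>p'\<close>, \<open>q'\<close> select the ends of two
  paths from an increasing 4-tuple. The slack \<open>+ 2\<close> leaves room to extend a pair of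
  indices to such a tuple, and \<open>8 \<le> M\<close> provides the small indices used
  below.\<close>

locale homogeneous_paths =
  fixes adj :: "'a \<Rightarrow> 'a \<Rightarrow> bool" and V :: "'a set" and c :: "nat \<Rightarrow> 'a"
    and P :: "nat \<Rightarrow> nat \<Rightarrow> 'a list" and M len :: nat
  assumes sym: "adj x y \<Longrightarrow> adj y x"
    and large: "8 \<le> M"
    and path: "\<lbrakk>i < j; j + 2 < M\<rbrakk> \<Longrightarrow> path_within adj V (c i) (P i j) (c j) \<and> length (P i j) = Suc len"
    and disjoint: "\<lbrakk>i < j; j < k; k < l; l + 2 < M\<rbrakk> \<Longrightarrow> set (P i j) \<inter> set (P k l) = {}"
    and homogeneous: "\<lbrakk>x0 < x1; x1 < x2; x2 < x3; x3 < M; y0 < y1; y1 < y2; y2 < y3; y3 < M;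
      p < 4; q < 4; p' < 4; q' < 4; t \<le> len; t' \<le> len;
      P ([x0, x1, x2, x3] ! p) ([x0, x1, x2, x3] ! q) ! t =
      P ([x0, x1, x2, x3] ! p') ([x0, x1, x2, x3] ! q') ! t'\<rbrakk> \<Longrightarrow>
      P ([y0, y1, y2, y3] ! p) ([y0, y1, y2, y3] ! q) ! t =
      P ([y0, y1, y2, y3] ! p') ([y0, y1, y2, y3] ! q') ! t'"
begin

section \<open>Coincidences between vertices of homogeneous paths\<close>

text \<open>Positions at which the vertex of \<open>P i j\<close> is determined by \<open>i\<close>, respectively by \<open>j\<close>.\<close>

definition source_pos :: "nat \<Rightarrow> bool" where
  "source_pos t \<longleftrightarrow> P 0 1 ! t = P 0 2 ! t"

definition target_pos :: "nat \<Rightarrow> bool" where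
  "target_pos t \<longleftrightarrow> P 0 2 ! t = P 1 2 ! t"

lemma source_pos_iff:
  assumes "i < j" "j < k" "k + 2 < M" "t \<le> len"
  shows "source_pos t \<longleftrightarrow> P i j ! t = P i k ! t"
  \<comment> \<open>The index \<open>M - 1\<close> pads the triple to a 4-tuple; the two instances
    give the two directions.\<close>
  using homogeneous[of i j k "M - 1" 0 1 2 3 0 1 0 2 t t]
    homogeneous[of 0 1 2 3 i j k "M - 1" 0 1 0 2 t t] assms large
  by (auto simp: source_pos_def)

lemma target_pos_iff:
  assumes "i < k" "k < j" "j + 2 < M" "t \<le> len"
  shows "target_pos t \<longleftrightarrow> P i j ! t = P k j ! t"
  using homogeneous[of i k j "M - 1" 0 1 2 3 0 2 1 2 t t]
    homogeneous[of 0 1 2 3 i k j "M - 1" 0 2 1 2 t t] assms large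
  by (auto simp: target_pos_def)

lemma nth_in: "\<lbrakk>i < j; j + 2 < M; t \<le> len\<rbrakk> \<Longrightarrow> P i j ! t \<in> set (P i j)"
  using path by simp

text \<open>Otherwise \<open>P 0 1\<close>, \<open>P 0 3\<close> and \<open>P 2 3\<close> would
  share their vertex at \<open>t\<close>, against \<open>disjoint\<close>.\<close>

lemma not_source_and_target:
  assumes "t \<le> len" "source_pos t" "target_pos t"
  shows False
proof -
  have "P 0 1 ! t = P 2 3 ! t"
    using source_pos_iff[of 0 1 3 t] target_pos_iff[of 0 2 3 t] assms large by simp
  then show False using nth_in[of 0 1 t] nth_in[of 2 3 t] disjoint[of 0 1 2 3] assms large by auto
qed

text \<open>Transfer the equality to sources 0, 1, 2 and target 3: vertices equated with a common
  third one agree with each other, once at position \<open>t\<close> and once at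
  \<open>t'\<close>.\<close>

lemma same_target:
  assumes "i < k" "k < j" "j + 2 < M" "t \<le> len" "t' \<le> len" "P i j ! t = P k j ! t'"
  shows "target_pos t \<and> target_pos t'"
proof -
  have *: "P y0 y2 ! t = P y1 y2 ! t'" if "y0 < y1" "y1 < y2" "y2 + 2 < M" for y0 y1 y2
    using homogeneous[of i k j "M - 1" y0 y1 y2 "M - 1" 0 2 1 2 t t'] that assms by simp
  from *[of 0 2 3] *[of 1 2 3] *[of 0 1 3] show ?thesis
    using target_pos_iff[of 0 1 3] target_pos_iff[of 1 2 3] assms large by simp
qed

lemma same_source:
  assumes "i < j" "j < k" "k + 2 < M" "t \<le> len" "t' \<le> len" "P i j ! t = P i k ! t'"
  shows "source_pos t \<and> source_pos t'"
proof -
  have *: "P y0 y1 ! t = P y0 y2 ! t'" if "y0 < y1" "y1 < y2" "y2 + 2 < M" for y0 y1 y2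
    using homogeneous[of i j k "M - 1" y0 y1 y2 "M - 1" 0 1 0 2 t t'] that assms by simp
  from *[of 0 1 2] *[of 0 1 3] *[of 0 2 3] show ?thesis
    using source_pos_iff[of 0 1 2] source_pos_iff[of 0 2 3] assms large by simp
qed

text \<open>By homogeneity \<open>P k l\<close> can be held fixed while either end of
  \<open>P i j\<close> moves, so \<open>t\<close> would be both a source and a target
  position.\<close>

lemma crossing:
  assumes "i < k" "k < j" "j < l" "l + 2 < M" "t \<le> len" "t' \<le> len"
  shows "P i j ! t \<noteq> P k l ! t'"
proof
  assume "P i j ! t = P k l ! t'"
  then have *: "P y0 y2 ! t = P y1 y3 ! t'"
    if "y0 < y1" "y1 < y2" "y2 < y3" "y3 < M" for y0 y1 y2 y3
    using homogeneous[of i k j l y0 y1 y2 y3 0 2 1 3 t t'] that assms by simp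
  from *[of 0 2 3 4] *[of 1 2 3 4] have "target_pos t"
    using target_pos_iff[of 0 1 3 t] assms large by simp
  moreover from *[of 0 1 2 4] *[of 0 1 3 4] have "source_pos t"
    using source_pos_iff[of 0 2 3 t] assms large by simp
  ultimately show False using not_source_and_target assms by blast
qed

text \<open>As for \<open>crossing\<close>, with the inner path held fixed while either end of the
  outer one moves.\<close>

lemma nesting:
  assumes "i < k" "k < l" "l < j" "j + 2 < M" "t \<le> len" "t' \<le> len"
  shows "P i j ! t \<noteq> P k l ! t'"
proof
  assume "P i j ! t = P k l ! t'"
  then have *: "P y0 y3 ! t = P y1 y2 ! t'"
    if "y0 < y1" "y1 < y2" "y2 < y3" "y3 < M" for y0 y1 y2 y3
    using homogeneous[of i k l j y0 y1 y2 y3 0 3 1 2 t t'] that assms by simp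
  from *[of 0 2 3 4] *[of 1 2 3 4] have "target_pos t"
    using target_pos_iff[of 0 1 4 t] assms large by simp
  moreover from *[of 0 1 2 3] *[of 0 1 2 4] have "source_pos t"
    using source_pos_iff[of 0 3 4 t] assms large by simp
  ultimately show False using not_source_and_target assms by blast
qed

text \<open>The pair \<open>(0, len)\<close> qualifies, as paths begin at \<open>c i\<close> and end
  at \<open>c j\<close>; a pair at minimal distance has no further source or target position in
  between.\<close>

lemma segment_exists:
  obtains a b where "a < b" "b \<le> len" "source_pos a" "target_pos b"
    "\<And>t. \<lbrakk>a \<le> t; t \<le> b; source_pos t\<rbrakk> \<Longrightarrow> t = a"
    "\<And>t. \<lbrakk>a \<le> t; t \<le> b; target_pos t\<rbrakk> \<Longrightarrow> t = b"
proof -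
  let ?good = "\<lambda>(a, b). a < b \<and> b \<le> len \<and> source_pos a \<and> target_pos b"
  have ends: "P i j ! 0 = c i \<and> P i j ! len = c j" if "i < j" "j + 2 < M" for i j
    using path[OF that] hd_conv_nth[of "P i j"] last_conv_nth[of "P i j"]
    by (auto simp: path_within_def)
  have "source_pos 0" "target_pos len"
    using ends[of 0 1] ends[of 0 2] ends[of 1 2] large by (auto simp: source_pos_def target_pos_def)
  moreover from this have "len \<noteq> 0" using not_source_and_target[of 0] by (cases len) auto
  ultimately have "?good (0, len)" by simp
  from ex_has_least_nat[of ?good, OF this, of "\<lambda>(a, b). b - a"]
  obtain a b where ab: "a < b" "b \<le> len" "source_pos a" "target_pos b"
    and least: "\<And>a' b'. ?good (a', b') \<Longrightarrow> b - a \<le> b' - a'" by auto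
  have "t = a" if "a \<le> t" "t \<le> b" "source_pos t" for t
    using least[of t b] that ab not_source_and_target[of b] by (cases "t = b") auto
  moreover have "t = b" if "a \<le> t" "t \<le> b" "target_pos t" for t
    using least[of a t] that ab not_source_and_target[of a] by (cases "t = a") auto
  ultimately show thesis using ab that by blast
qed

text \<open>As both left ends precede both right ends, the index intervals coincide, share one end,
  cross or nest. The last two are excluded; a shared left end forces both positions to be
  \<open>a\<close>, a shared right end forces \<open>b\<close>; and a single path repeats no
  vertex.\<close>

lemma segment_collision:
  assumes bound: "b \<le> len"
    and source: "\<And>t. \<lbrakk>a \<le> t; t \<le> b; source_pos t\<rbrakk> \<Longrightarrow> t = a"
    and target: "\<And>t. \<lbrakk>a \<le> t; t \<le> b; target_pos t\<rbrakk> \<Longrightarrow> t = b"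
    and lt: "i < j" "i < l" "k < j" "k < l" "j + 2 < M" "l + 2 < M"
    and t: "a \<le> t" "t \<le> b" "a \<le> t'" "t' \<le> b"
    and eq: "P i j ! t = P k l ! t'"
  shows "t = t' \<and> (t = a \<or> j = l) \<and> (t = b \<or> i = k)"
proof -
  have le: "t \<le> len" "t' \<le> len" using bound t by auto
  consider "i = k" "j = l" | "i = k" "j < l" | "i = k" "l < j" | "i < k" "j = l" | "k < i" "j = l"
    | "i < k" "j < l" | "i < k" "l < j" | "k < i" "j < l" | "k < i" "l < j"
    by (meson linorder_neqE_nat)
  then show ?thesis
  proof cases
    case 1
    then show ?thesis using eq path[of i j] le lt by (auto simp: nth_eq_iff_index_eq path_within_def)
  next
    case 2
    then show ?thesis using same_source[of i j l t t'] source[of t] source[of t'] eq lt t le by auto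
  next
    case 3
    then show ?thesis using same_source[of i l j t' t] source[of t] source[of t'] eq lt t le by auto
  next
    case 4
    then show ?thesis using same_target[of i k j t t'] target[of t] target[of t'] eq lt t le by auto
  next
    case 5
    then show ?thesis using same_target[of k i j t' t] target[of t] target[of t'] eq lt t le by auto
  next
    case 6
    then show ?thesis using crossing[of i k j l t t'] eq lt le by auto
  next
    case 7
    then show ?thesis using nesting[of i k l j t t'] eq lt le by auto
  next
    case 8
    then show ?thesis using nesting[of k i j l t' t] eq lt le by auto
  next
    case 9
    then show ?thesis using crossing[of k i l j t' t] eq lt le by auto
  qed
qed

section \<open>Embedding the subdivided clique\<close>

text \<open>The pair \<open>i < k\<close> of branch vertices is joined by following \<open>P i j\<close> up to its target position and
  \<open>P k j\<close> back, for an index \<open>j\<close> reserved for this pair.\<close>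

lemma subdivided_clique:
  "\<exists>D\<in>{1..len}. \<forall>t. t * t + t + 4 \<le> M \<longrightarrow>
    (\<exists>f. inj_on f (pverts (d_subdivision (2 * D - 1) (complete_graph t))) \<and>
      f ` pverts (d_subdivision (2 * D - 1) (complete_graph t)) \<subseteq> V \<and>
      (\<forall>(u, v)\<in>parcs (d_subdivision (2 * D - 1) (complete_graph t)). adj (f u) (f v)))"
proof -
  obtain a b where ab: "a < b" "b \<le> len" "source_pos a"
    and source: "\<And>t. \<lbrakk>a \<le> t; t \<le> b; source_pos t\<rbrakk> \<Longrightarrow> t = a"
    and target: "\<And>t. \<lbrakk>a \<le> t; t \<le> b; target_pos t\<rbrakk> \<Longrightarrow> t = b"
    and "target_pos b"
    by (rule segment_exists) blast
  note collision = segment_collision[OF ab(2) source target]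
  \<comment> \<open>Each edge of the clique becomes two segments of length \<open>D\<close>, hence
    has \<open>2 * D - 1\<close> inner vertices; \<open>D\<close> is fixed before the clique
    size.\<close>
  define D where "D = b - a"
  have D: "1 \<le> D" "D \<le> len" "b = a + D" using ab by (auto simp: D_def)
  have "\<exists>f. inj_on f (pverts (d_subdivision (2 * D - 1) (complete_graph t))) \<and>
      f ` pverts (d_subdivision (2 * D - 1) (complete_graph t)) \<subseteq> V \<and>
      (\<forall>(u, v)\<in>parcs (d_subdivision (2 * D - 1) (complete_graph t)). adj (f u) (f v))"
    if t: "t * t + t + 4 \<le> M" for t
  proof -
    \<comment> \<open>The index reserved for the pair, written in base \<open>t\<close> and shifted
      past the branch indices below \<open>t\<close>.\<close>
    define \<sigma> where "\<sigma> i k = t + i * t + k" for i k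
    have \<sigma>: "t \<le> \<sigma> i k" "\<sigma> i k + 2 < M" if "i < t" "k < t" for i k
    proof -
      have "Suc i * t \<le> t * t" using that by (intro mult_le_mono1) simp
      then show "\<sigma> i k + 2 < M" using that t by (simp add: \<sigma>_def)
    qed (simp add: \<sigma>_def)
    have \<sigma>_inj: "i = i' \<and> k = k'" if "\<sigma> i k = \<sigma> i' k'" "k < t" "k' < t" for i k i' k'
    proof -
      have "i * t + k = i' * t + k'" using that by (simp add: \<sigma>_def)
      then have "(i * t + k) div t = (i' * t + k') div t" "(i * t + k) mod t = (i' * t + k') mod t"
        by simp_all
      then show ?thesis using that by simp
    qed
    \<comment> \<open>Since \<open>a\<close> is a source position, any later index could serve to
      name the branch vertex of \<open>i\<close>; \<open>t\<close> lies above all branch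
      indices.\<close>
    define f where "f x = (case x of Orig i \<Rightarrow> P i t ! a
      | Inner i k s \<Rightarrow> if s \<le> D then P i (\<sigma> i k) ! (a + s) else P k (\<sigma> i k) ! (a + 2 * D - s))" for x
    let ?H = "d_subdivision (2 * D - 1) (complete_graph t)"
    have verts: "pverts ?H = Orig ` {..<t} \<union> {Inner i k s | i k s. i < k \<and> k < t \<and> 1 \<le> s \<and> s < 2 * D}"
      using D(1) by (auto simp: d_subdivision_def complete_graph_def Let_def)
    have tM: "t + 2 < M" using t by simp
    \<comment> \<open>The midpoint \<open>s = D\<close> is read off the path from \<open>i\<close>
      only, so \<open>x = k\<close> comes with \<open>\<tau> \<noteq> b\<close>; thus
      \<open>x\<close> and \<open>\<tau>\<close> determine \<open>s\<close>.\<close>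
    have inner: "\<exists>x \<tau>. f (Inner i k s) = P x (\<sigma> i k) ! \<tau> \<and> x < t \<and> a < \<tau> \<and> \<tau> \<le> b \<and>
        (x = i \<and> \<tau> = a + s \<or> x = k \<and> \<tau> \<noteq> b \<and> \<tau> + s = a + 2 * D)"
      if "i < k" "k < t" "1 \<le> s" "s < 2 * D" for i k s
    proof (cases "s \<le> D")
      case True
      then show ?thesis using that D
        by (intro exI[of _ i] exI[of _ "a + s"]) (auto simp: f_def)
    next
      case False
      then show ?thesis using that D
        by (intro exI[of _ k] exI[of _ "a + 2 * D - s"]) (auto simp: f_def)
    qed
    have "inj_on f (pverts ?H)"
    proof (rule inj_onI)
      fix x y assume x: "x \<in> pverts ?H" and y: "y \<in> pverts ?H" and eq: "f x = f y"
      have branch_inner: "f (Orig i') \<noteq> f (Inner i k s)"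
        if iks: "i' < t" "i < k" "k < t" "1 \<le> s" "s < 2 * D" for i i' k s
      proof
        assume e: "f (Orig i') = f (Inner i k s)"
        obtain x \<tau> where "f (Inner i k s) = P x (\<sigma> i k) ! \<tau>" "x < t" "a < \<tau>" "\<tau> \<le> b"
          using inner[OF iks(2-5)] by blast
        then show False
          using collision[of i' t "\<sigma> i k" x a \<tau>] e iks \<sigma>[of i k] tM ab by (auto simp: f_def)
      qed
      from x y consider i i' where "x = Orig i" "y = Orig i'" "i < t" "i' < t"
        | i i' k s where "x = Orig i'" "y = Inner i k s" "i' < t" "i < k" "k < t" "1 \<le> s" "s < 2 * D"
        | i i' k s where "y = Orig i'" "x = Inner i k s" "i' < t" "i < k" "k < t" "1 \<le> s" "s < 2 * D"
        | i k s i' k' s' where "x = Inner i k s" "y = Inner i' k' s'"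
            "i < k" "k < t" "1 \<le> s" "s < 2 * D" "i' < k'" "k' < t" "1 \<le> s'" "s' < 2 * D"
        unfolding verts by blast
      then show "x = y"
      proof cases
        case (1 i i')
        then show ?thesis using collision[of i t t i' a a] eq tM ab by (auto simp: f_def)
      next
        case (2 i i' k s)
        then show ?thesis using branch_inner[of i' i k s] eq by auto
      next
        case (3 i i' k s)
        then show ?thesis using branch_inner[of i' i k s] eq by auto
      next
        case (4 i k s i' k' s')
        obtain x1 \<tau> where 1: "f (Inner i k s) = P x1 (\<sigma> i k) ! \<tau>" "x1 < t" "a < \<tau>" "\<tau> \<le> b"
          "x1 = i \<and> \<tau> = a + s \<or> x1 = k \<and> \<tau> \<noteq> b \<and> \<tau> + s = a + 2 * D"
          using inner[OF 4(3-6)] by blast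
        obtain x2 \<tau>' where 2: "f (Inner i' k' s') = P x2 (\<sigma> i' k') ! \<tau>'" "x2 < t" "a < \<tau>'" "\<tau>' \<le> b"
          "x2 = i' \<and> \<tau>' = a + s' \<or> x2 = k' \<and> \<tau>' \<noteq> b \<and> \<tau>' + s' = a + 2 * D"
          using inner[OF 4(7-10)] by blast
        \<comment> \<open>Inner positions lie beyond \<open>a\<close>, so a collision forces equal
          reserved indices and hence the same pair.\<close>
        have "\<tau> = \<tau>' \<and> (\<tau> = a \<or> \<sigma> i k = \<sigma> i' k') \<and> (\<tau> = b \<or> x1 = x2)"
          using collision[of x1 "\<sigma> i k" "\<sigma> i' k'" x2 \<tau> \<tau>'] eq 1(1-4) 2(1-4) 4 \<sigma>[of i k] \<sigma>[of i' k']
          by auto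
        moreover from this have "i = i'" "k = k'" using \<sigma>_inj[of i k i' k'] 1(3) 4 by auto
        ultimately show ?thesis using 1(5) 2(5) 4 by auto
      qed
    qed
    moreover have PV: "P i j ! \<tau> \<in> V" if "i < j" "j + 2 < M" "\<tau> \<le> b" for i j \<tau>
      using nth_in[of i j \<tau>] path[of i j] that ab by (auto simp: path_within_def)
    have "f ` pverts ?H \<subseteq> V"
    proof
      fix v assume "v \<in> f ` pverts ?H"
      then consider i where "v = f (Orig i)" "i < t"
        | i k s where "v = f (Inner i k s)" "i < k" "k < t" "1 \<le> s" "s < 2 * D"
        unfolding verts by blast
      then show "v \<in> V"
      proof cases
        case (1 i)
        then show ?thesis using PV[of i t a] tM ab by (simp add: f_def)
      next
        case (2 i k s)
        then obtain x \<tau> where "v = P x (\<sigma> i k) ! \<tau>" "x < t" "\<tau> \<le> b" using inner[of i k s] by blast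
        then show ?thesis using PV[of x "\<sigma> i k" \<tau>] \<sigma>[of i k] 2 by auto
      qed
    qed
    moreover have "\<forall>(u, v)\<in>parcs ?H. adj (f u) (f v)"
    proof -
      \<comment> \<open>\<open>g\<close> continues the formula for inner vertices to
        \<open>s = 0\<close> and \<open>s = 2 * D\<close>, where it yields the branch vertices
        because \<open>a\<close> is a source position.\<close>
      define g where "g i k s = (if s \<le> D then P i (\<sigma> i k) ! (a + s) else P k (\<sigma> i k) ! (a + 2 * D - s))"
        for i k s
      have branch: "P i t ! a = P i (\<sigma> i' k) ! a" if "i < t" "i' < t" "k < t" for i i' k
        using source_pos_iff[of i t "\<sigma> i' k" a] \<sigma>[of i' k] that ab
        by (cases "\<sigma> i' k = t") auto
      have fg: "f (subdiv_path (2 * D - 1) i k s) = g i k s" if "i < k" "k < t" "s \<le> 2 * D" for i k s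
        using that D branch[of i i k] branch[of k i k] by (auto simp: subdiv_path_def f_def g_def)
      have step: "adj (P i j ! \<tau>) (P i j ! Suc \<tau>)" if "i < j" "j + 2 < M" "\<tau> < len" for i j \<tau>
        using path[of i j] that by (auto simp: path_within_def successively_conv_nth)
      have "adj (g i k s) (g i k (Suc s))" if "i < k" "k < t" "s < 2 * D" for i k s
      proof -
        consider "s < D" | "s = D" | "D < s" by linarith
        then show ?thesis
        proof cases
          case 1
          then show ?thesis using step[of i "\<sigma> i k" "a + s"] that \<sigma>[of i k] D ab by (auto simp: g_def)
        next
          case 2
          \<comment> \<open>The turning point: the two segments meet because \<open>b\<close> is a
            target position.\<close>
          have "P i (\<sigma> i k) ! b = P k (\<sigma> i k) ! b"
            using target_pos_iff[of i k "\<sigma> i k" b] \<open>target_pos b\<close> \<sigma>[of i k] that ab by auto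
          moreover have "Suc (a + 2 * D - Suc s) = b" using 2 D by simp
          ultimately show ?thesis
            using 2 sym[OF step[of k "\<sigma> i k" "a + 2 * D - Suc s"]] that \<sigma>[of i k] D ab by (auto simp: g_def add.commute)
        next
          case 3
          then have "Suc (a + 2 * D - Suc s) = a + 2 * D - s" using that by simp
          then show ?thesis
            using 3 sym[OF step[of k "\<sigma> i k" "a + 2 * D - Suc s"]] that \<sigma>[of i k] D ab by (auto simp: g_def)
        qed
      qed
      then have "adj (f (subdiv_path (2 * D - 1) i k s)) (f (subdiv_path (2 * D - 1) i k (s + 1)))"
        if "i < k" "k < t" "s \<le> 2 * D - 1" for i k s
        using fg[of i k s] fg[of i k "s + 1"] that D by auto
      then show ?thesis using sym by (auto simp: d_subdivision_def complete_graph_def Let_def)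
    qed
    ultimately show ?thesis by blast
  qed
  then show ?thesis using D by (intro bexI[of _ D]) auto
qed

end

section \<open>Bounding the number of progressing moves\<close>

text \<open>Paths in a long play have length at most \<open>r\<close>, so the resulting subdivided
  clique has \<open>D \<le> r\<close>. Only finitely many subdivisions matter, and one play length
  serves the whole class.\<close>

lemma nowhere_dense_bounded_set_win:
  fixes \<C> :: "('a, 'b) pre_digraph set"
  assumes graphs: "\<And>G. G \<in> \<C> \<Longrightarrow> graph G" and nd: "nowhere_dense \<C>"
  shows "\<exists>L. \<forall>G\<in>\<C>. set_win (dominates G) r L (verts G)"
proof -
  obtain \<tau> where \<tau>: "\<forall>D. \<forall>G\<in>\<C>.
      \<not> contains_subgraph G (with_proj (d_subdivision (2 * D - 1) (complete_graph (\<tau> D))))"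
    by (rule that, rule allI, rule someI_ex[OF spec[OF nd[unfolded nowhere_dense_def]]])
  \<comment> \<open>\<open>D\<close> is known only after Ramsey's theorem has been applied, so
    \<open>T\<close> dominates \<open>\<tau> D\<close> for all candidates; \<open>M\<close> then
    meets both \<open>large\<close> and the bound in \<open>subdivided_clique\<close>.\<close>
  define T where "T = (\<Sum>D\<le>r. \<tau> D)"
  define M where "M = T * T + T + 8"
  define indices where "indices = {..<4::nat} \<times> {..<4::nat} \<times> {..<4::nat} \<times> {..<4::nat} \<times> {..r} \<times> {..r}"
  \<comment> \<open>A colour records the length of the path between the first two indices and all
    coincidences among paths on the four indices.\<close>
  define K where "K = {..Suc r} \<times> Pow indices"
  have "finite K" by (simp add: K_def indices_def)
  from ramsey_increasing[OF this, of M] obtain N :: nat where N: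
    "\<And>f. \<forall>i j k l. i < j \<longrightarrow> j < k \<longrightarrow> k < l \<longrightarrow> l < N \<longrightarrow> f i j k l \<in> K \<Longrightarrow>
      \<exists>e col. (\<forall>j<M. e j < N) \<and> (\<forall>i j. i < j \<longrightarrow> j < M \<longrightarrow> e i < e j) \<and>
        (\<forall>i j k l. i < j \<longrightarrow> j < k \<longrightarrow> k < l \<longrightarrow> l < M \<longrightarrow> f (e i) (e j) (e k) (e l) = col)"
    by blast
  have "set_win (dominates G) r (N * Suc (N * Suc r)) (verts G)" if G: "G \<in> \<C>" for G
  proof (rule ccontr)
    let ?adj = "dominates G"
    interpret graph G using graphs G .
    assume "\<not> ?thesis"
    from long_play_paths[OF this] obtain c P where
      P: "\<And>i j. i < j \<Longrightarrow> j < N \<Longrightarrow> path_within ?adj (verts G) (c i) (P i j) (c j) \<and> length (P i j) \<le> Suc r"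
      and disj: "\<And>i j k l. i < j \<Longrightarrow> j < k \<Longrightarrow> k < l \<Longrightarrow> l < N \<Longrightarrow> set (P i j) \<inter> set (P k l) = {}"
      by blast
    \<comment> \<open>Index pairs that are not increasing and positions past the end of a path give
      unspecified values, which merely refine the colouring.\<close>
    define pat where "pat xs = {(p, q, p', q', t, t') \<in> indices.
        P (xs ! p) (xs ! q) ! t = P (xs ! p') (xs ! q') ! t'}" for xs
    have "\<forall>i j k l. i < j \<longrightarrow> j < k \<longrightarrow> k < l \<longrightarrow> l < N \<longrightarrow> (length (P i j), pat [i, j, k, l]) \<in> K"
      using P by (auto simp: K_def pat_def)
    from N[OF this] obtain e col where e: "\<And>j. j < M \<Longrightarrow> e j < N" "\<And>i j. i < j \<Longrightarrow> j < M \<Longrightarrow> e i < e j"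
      and col: "\<And>i j k l. i < j \<Longrightarrow> j < k \<Longrightarrow> k < l \<Longrightarrow> l < M \<Longrightarrow>
        (length (P (e i) (e j)), pat [e i, e j, e k, e l]) = col"
      by metis
    define len where "len = length (P (e 0) (e 1)) - 1"
    have eP: "path_within ?adj (verts G) (c (e i)) (P (e i) (e j)) (c (e j))"
      "length (P (e i) (e j)) \<le> Suc r" if "i < j" "j < M" for i j
      using P[of "e i" "e j"] e that by auto
    have "P (e 0) (e 1) \<noteq> []" using eP(1)[of 0 1] by (simp add: M_def path_within_def)
    then have len: "length (P (e 0) (e 1)) = Suc len" by (simp add: len_def)
    then have "len \<le> r" using eP(2)[of 0 1] by (simp add: M_def)
    interpret H: homogeneous_paths ?adj "verts G" "\<lambda>i. c (e i)" "\<lambda>i j. P (e i) (e j)" M len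
    proof
      fix x y assume "?adj x y" then show "?adj y x" using sym_arcs by (rule arcs_ends_symmetric[rotated])
    next
      fix i j assume ij: "i < j" "j + 2 < M"
      have "length (P (e i) (e j)) = length (P (e 0) (e 1))"
        using col[of i j "j + 1" "j + 2"] col[of 0 1 2 3] ij by (auto simp: M_def)
      then show "path_within ?adj (verts G) (c (e i)) (P (e i) (e j)) (c (e j)) \<and>
          length (P (e i) (e j)) = Suc len"
        using eP(1)[of i j] ij len by simp
    next
      fix i j k l assume "i < j" "j < k" "k < l" "l + 2 < M"
      then show "set (P (e i) (e j)) \<inter> set (P (e k) (e l)) = {}" by (intro disj e) auto
    next
      fix x0 x1 x2 x3 y0 y1 y2 y3 p q p' q' t t' :: nat
      assume lt: "x0 < x1" "x1 < x2" "x2 < x3" "x3 < M" "y0 < y1" "y1 < y2" "y2 < y3" "y3 < M"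
        and idx: "p < 4" "q < 4" "p' < 4" "q' < 4" "t \<le> len" "t' \<le> len"
        and eq: "P (e ([x0, x1, x2, x3] ! p)) (e ([x0, x1, x2, x3] ! q)) ! t =
          P (e ([x0, x1, x2, x3] ! p')) (e ([x0, x1, x2, x3] ! q')) ! t'"
      have map: "[e a0, e a1, e a2, e a3] ! n = e ([a0, a1, a2, a3] ! n)" if "n < 4" for a0 a1 a2 a3 n
        using nth_map[of n "[a0, a1, a2, a3]" e] that by simp
      have "(p, q, p', q', t, t') \<in> pat [e x0, e x1, e x2, e x3]"
        using eq idx \<open>len \<le> r\<close> by (auto simp: pat_def indices_def map simp del: nth_Cons_numeral)
      moreover have "pat [e x0, e x1, e x2, e x3] = pat [e y0, e y1, e y2, e y3]"
        using col[OF lt(1-4)] col[OF lt(5-8)] by auto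
      ultimately have "(p, q, p', q', t, t') \<in> pat [e y0, e y1, e y2, e y3]" by simp
      then show "P (e ([y0, y1, y2, y3] ! p)) (e ([y0, y1, y2, y3] ! q)) ! t =
          P (e ([y0, y1, y2, y3] ! p')) (e ([y0, y1, y2, y3] ! q')) ! t'"
        using idx by (simp add: pat_def map)
    qed (simp add: M_def)
    from H.subdivided_clique obtain D where D: "D \<in> {1..len}"
      and clique: "\<And>t. t * t + t + 4 \<le> M \<Longrightarrow> \<exists>f. inj_on f (pverts (d_subdivision (2 * D - 1) (complete_graph t))) \<and>
        f ` pverts (d_subdivision (2 * D - 1) (complete_graph t)) \<subseteq> verts G \<and>
        (\<forall>(u, v)\<in>parcs (d_subdivision (2 * D - 1) (complete_graph t)). ?adj (f u) (f v))"
      by blast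
    have "\<tau> D \<le> T" unfolding T_def using D \<open>len \<le> r\<close> by (intro member_le_sum) auto
    then have "\<tau> D * \<tau> D + \<tau> D + 4 \<le> M" using mult_le_mono[of "\<tau> D" T "\<tau> D" T] by (simp add: M_def)
    from clique[OF this] \<tau> G show False
      using contains_subgraph_iff[OF wf_digraph_axioms pair_wf_d_subdivision_complete] by blast
  qed
  then show ?thesis by blast
qed

section \<open>From walks in digraphs to the game on vertex sets\<close>

context wf_digraph
begin

lemma awalk_list:
  assumes "p \<noteq> []" "set p \<subseteq> verts G" "successively (dominates G) p"
  shows "\<exists>w. awalk (hd p) w (last p) \<and> Suc (length w) = length p"
  using assms
proof (induction p rule: induct_list012)
  case (2 x)
  then show ?case by (intro exI[of _ "[]"]) (simp add: awalk_Nil_iff)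
next
  case (3 x y zs)
  then obtain w where w: "awalk y w (last (y # zs))" "Suc (length w) = length (y # zs)" by auto
  from 3 obtain a where "a \<in> arcs G" "tail G a = x" "head G a = y" by (auto simp: arcs_ends_conv)
  with w show ?case by (intro exI[of _ "a # w"]) (auto simp: awalk_Cons_iff)
qed simp

lemma successively_awalk_verts:
  "awalk u p v \<Longrightarrow> successively (dominates G) (awalk_verts u p)"
proof (induction p arbitrary: u)
  case (Cons a p)
  then have a: "a \<in> arcs G" "tail G a = u" "awalk (head G a) p v" by (auto simp: awalk_Cons_iff)
  then have "hd (awalk_verts (head G a) p) = head G a" by blast
  with a Cons.IH show ?case by (auto simp: successively_Cons arcs_ends_conv)
qed simp

lemma dist_ball_eq_set_ball:
  "dist_ball G r c = set_ball (dominates G) r (verts G) c"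
proof (intro set_eqI iffI)
  fix v assume "v \<in> dist_ball G r c"
  then obtain p where p: "awalk c p v" "length p \<le> r" unfolding dist_ball_iff by blast
  let ?q = "awalk_to_apath p"
  have q: "apath c ?q v" by (rule apath_awalk_to_apath[OF p(1)])
  then have awalk: "awalk c ?q v" and dist: "distinct (awalk_verts c ?q)" by (auto simp: apath_def)
  \<comment> \<open>The shortened walk has distinct arcs, all taken from \<open>p\<close>, so
    comparing cardinalities bounds its length.\<close>
  have "distinct ?q" by (rule distinct_verts_imp_distinct[OF awalk dist])
  then have "length ?q \<le> card (set p)"
    using card_mono[OF _ awalk_to_apath_subset[OF p(1)]] by (simp add: distinct_card)
  then have "length ?q \<le> r" using card_length[of p] p(2) by linarith
  moreover have "path_within (dominates G) (verts G) c (awalk_verts c ?q) v"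
    using awalk dist successively_awalk_verts[OF awalk] by (auto simp: path_within_def)
  ultimately show "v \<in> set_ball (dominates G) r (verts G) c"
    unfolding set_ball_def by (auto simp: length_awalk_verts intro!: exI[of _ "awalk_verts c ?q"])
next
  fix v assume "v \<in> set_ball (dominates G) r (verts G) c"
  then obtain p where p: "path_within (dominates G) (verts G) c p v" "length p \<le> Suc r"
    unfolding set_ball_def by blast
  then obtain w where "awalk c w v" "Suc (length w) = length p"
    using awalk_list[of p] by (auto simp: path_within_def)
  with p(2) show "v \<in> dist_ball G r c" unfolding dist_ball_iff by auto
qed

lemma dist_ball_induce:
  "dist_ball (G \<restriction> A) r c = set_ball (dominates G) r A c"
proof -
  interpret A: wf_digraph "G \<restriction> A" by (rule wellformed_induce_subgraph)
  have "successively (dominates (G \<restriction> A)) p \<longleftrightarrow>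
      successively (dominates G) p" if "set p \<subseteq> A" for p
    using that by (intro successively_cong) (auto simp: arcs_ends_conv)
  then have "path_within (dominates (G \<restriction> A)) A c p v \<longleftrightarrow>
      path_within (dominates G) A c p v" for p v
    by (auto simp: path_within_def)
  then show ?thesis using A.dist_ball_eq_set_ball by (simp add: set_ball_def)
qed

lemma del_vert_induce: "pre_digraph.del_vert (G \<restriction> A) s = G \<restriction> (A - {s})"
  by (intro pre_digraph.equality) (auto simp: pre_digraph.del_vert_simps)

lemma next_arena_induce:
  "next_arena r (G \<restriction> A) c s = G \<restriction> (set_ball (dominates G) r A c - {s})"
proof -
  interpret A: wf_digraph "G \<restriction> A" by (rule wellformed_induce_subgraph)
  have "(G \<restriction> A) \<restriction> B = G \<restriction> B" if "B \<subseteq> A" for B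
    using that by (intro pre_digraph.equality) auto
  then show ?thesis
    using set_ball_subset by (metis next_arena_def dist_ball_induce del_vert_induce)
qed

text \<open>Arenas keep the form \<open>G \<restriction> A\<close>, so
  \<open>splitter_wins_Suc\<close>, which peels off the first round, matches the recursion of
  \<open>set_win\<close>.\<close>

lemma splitter_wins_iff_set_win:
  "(\<exists>\<sigma>. splitter_strategy r (G \<restriction> A) \<sigma> \<and> wins_within r (G \<restriction> A) \<sigma> l) \<longleftrightarrow>
    set_win (dominates G) r l A"
proof (induction l arbitrary: A)
  case (Suc l)
  show ?case by (simp only: splitter_wins_Suc next_arena_induce Suc.IH set_win.simps induce_subgraph_verts)
qed (simp add: splitter_wins_0)

lemma splitter_number_induce:
  "splitter_number r (G \<restriction> A) = (LEAST l. set_win (dominates G) r l A)"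
  by (simp add: splitter_number_def splitter_wins_iff_set_win)

text \<open>Every progressing vertex must hit a small losing set \<open>W\<close> in the ball. The
  sum makes the bound uniform over all Splitter numbers up to \<open>L\<close>.\<close>

lemma card_progressing_le:
  assumes "set_win (dominates G) r L (verts G)"
  shows "card {s \<in> verts G. r_progressing r G c s} \<le> (\<Sum>l\<le>L. obstruction_bound r l)"
proof -
  let ?win = "set_win (dominates G) r"
  define B where "B = dist_ball G r c"
  define n where "n = (LEAST l. ?win l B)"
  have win: "?win L B"
    by (rule set_win_mono[OF assms]) (auto simp: B_def dist_ball_def)
  then have "n \<le> L" unfolding n_def by (rule Least_le)
  show ?thesis
  proof (cases n)
    case 0
    then have "{s \<in> verts G. r_progressing r G c s} = {}"
      by (simp add: r_progressing_def splitter_number_induce del_vert_induce flip: B_def n_def)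
    then show ?thesis by (metis card.empty le0)
  next
    case (Suc m)
    then have "\<not> ?win m B" unfolding n_def using not_less_Least lessI by metis
    then obtain W where W: "W \<subseteq> B" "finite W" "card W \<le> obstruction_bound r m" "\<not> ?win m W"
      using small_obstruction by metis
    have "s \<in> W" if "r_progressing r G c s" for s
    proof (rule ccontr)
      assume "s \<notin> W"
      have "(LEAST l. ?win l (B - {s})) \<le> m"
        using that Suc by (simp add: r_progressing_def splitter_number_induce del_vert_induce flip: B_def n_def)
      \<comment> \<open>The least number is attained, since \<open>L\<close> rounds suffice on the
        smaller arena.\<close>
      moreover have "?win (LEAST l. ?win l (B - {s})) (B - {s})"
        by (rule LeastI[of _ L], rule set_win_mono[OF win]) auto
      ultimately have "?win m (B - {s})" by (rule set_win_le)
      then have "?win m W" by (rule set_win_mono) (use W(1) \<open>s \<notin> W\<close> in auto)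
      with W(4) show False ..
    qed
    then have "card {s \<in> verts G. r_progressing r G c s} \<le> card W" by (intro card_mono W) auto
    also have "\<dots> \<le> obstruction_bound r m" by (rule W)
    also have "\<dots> \<le> (\<Sum>l\<le>L. obstruction_bound r l)"
      using Suc \<open>n \<le> L\<close> by (intro member_le_sum) auto
    finally show ?thesis .
  qed
qed

end

theorem theorem6:
  fixes \<C> :: "('a, 'b) pre_digraph set" and r :: nat
  assumes graphs: "\<And>G. G \<in> \<C> \<Longrightarrow> graph G"
    and nd: "nowhere_dense \<C>"
  shows "\<exists>k::nat. \<forall>G\<in>\<C>. \<forall>c\<in>verts G. card {s \<in> verts G. r_progressing r G c s} \<le> k"
proof -
  obtain L where L: "\<And>G. G \<in> \<C> \<Longrightarrow> set_win (dominates G) r L (verts G)"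
    using nowhere_dense_bounded_set_win[OF graphs nd] by blast
  have "card {s \<in> verts G. r_progressing r G c s} \<le> (\<Sum>l\<le>L. obstruction_bound r l)"
    if G: "G \<in> \<C>" for G c
  proof -
    interpret graph G using graphs G .
    show ?thesis by (rule card_progressing_le[OF L[OF G]])
  qed
  then show ?thesis by blast
qed

end
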